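(* Thompson's group $F=\langle x_0,x_1 \mid [x_0x_1^{-1},x_0^{-1}x_1x_0],\ [x_0x_1^{-1},x_0^{-2}x_1x_0^{2}]\rangle$ has no regular language of geodesics with respect to the generating set $\{x_0,x_1\}$.
   Context: For a group $G$ with finite generating set $X$, words are finite strings over the alphabet $X\cup X^{-1}$; a word is geodesic if its length equals the word length (with respect to $X$) of the element of $G$ it represents. A language of geodesics for $G$ with respect to $X$ is a set of geodesic words that contains at least one representative of each element of $G$. A language is regular if it is accepted by a finite state automaton. *)

theory Defs
  imports "HOL-Algebra.Generated_Groups"
begin

section \<open>Group presentations\<close>

text \<open>A signed letter \<open>(a, True)\<close> stands for the generator \<open>a\<close>, and \<open>(a, False)\<close> for its formal
  inverse. The free generators are all elements of the type \<open>'a\<close>.\<close>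

type_synonym 'a word = "('a \<times> bool) list"

definition inv_word :: "'a word \<Rightarrow> 'a word" where
  "inv_word w = rev (map (\<lambda>(a, b). (a, \<not> b)) w)"

definition commutator_word :: "'a word \<Rightarrow> 'a word \<Rightarrow> 'a word" where
  "commutator_word u v = u @ v @ inv_word u @ inv_word v"

text \<open>Two words represent the same element of the group presented by the relators \<open>R\<close> iff one
  arises from the other by inserting and deleting relators and pairs of mutually inverse letters.\<close>

inductive pres_eq :: "'a word set \<Rightarrow> 'a word \<Rightarrow> 'a word \<Rightarrow> bool" for R :: "'a word set" where
  refl: "pres_eq R w w"
| sym: "pres_eq R u v \<Longrightarrow> pres_eq R v u"
| trans: "pres_eq R u v \<Longrightarrow> pres_eq R v w \<Longrightarrow> pres_eq R u w"
| cancel: "pres_eq R (u @ [(a, b), (a, \<not> b)] @ v) (u @ v)"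
| relator: "r \<in> R \<Longrightarrow> pres_eq R (u @ r @ v) (u @ v)"

definition pres_class :: "'a word set \<Rightarrow> 'a word \<Rightarrow> 'a word set" where
  "pres_class R u = {v. pres_eq R u v}"

definition presented_group :: "'a word set \<Rightarrow> 'a word set monoid" where
  "presented_group R =
    \<lparr>carrier = range (pres_class R),
     mult = (\<lambda>A B. \<Union>u\<in>A. \<Union>v\<in>B. pres_class R (u @ v)),
     one = pres_class R []\<rparr>"

definition pres_gen :: "'a word set \<Rightarrow> 'a \<Rightarrow> 'a word set" where
  "pres_gen R a = pres_class R [(a, True)]"

lemma pres_class_eq_iff: "pres_class R u = pres_class R v \<longleftrightarrow> pres_eq R u v"
  unfolding pres_class_def by (blast intro: pres_eq.intros)

lemma pres_eq_append_left: "pres_eq R u v \<Longrightarrow> pres_eq R (w @ u) (w @ v)"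
proof (induction rule: pres_eq.induct)
  case (cancel u a b v)
  then show ?case using pres_eq.cancel[of R "w @ u" a b v] by simp
next
  case (relator r u v)
  then show ?case using pres_eq.relator[of r R "w @ u" v] by simp
qed (blast intro: pres_eq.intros)+

lemma pres_eq_append_right: "pres_eq R u v \<Longrightarrow> pres_eq R (u @ w) (v @ w)"
proof (induction rule: pres_eq.induct)
  case (cancel u a b v)
  then show ?case using pres_eq.cancel[of R u a b "v @ w"] by simp
next
  case (relator r u v)
  then show ?case using pres_eq.relator[of r R u "v @ w"] by simp
qed (blast intro: pres_eq.intros)+

lemma pres_eq_append:
  "pres_eq R u u' \<Longrightarrow> pres_eq R v v' \<Longrightarrow> pres_eq R (u @ v) (u' @ v')"
  by (blast intro: pres_eq.trans pres_eq_append_left pres_eq_append_right)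

lemma pres_eq_inv_left: "pres_eq R (inv_word w @ w) []"
proof (induction w)
  case Nil
  then show ?case by (simp add: inv_word_def pres_eq.refl)
next
  case (Cons x w)
  obtain a b where x: "x = (a, b)" by (cases x)
  have "pres_eq R (inv_word w @ [(a, \<not> b), (a, \<not> \<not> b)] @ w) (inv_word w @ w)"
    by (rule pres_eq.cancel)
  then show ?case
    using Cons.IH by (auto simp: inv_word_def x intro: pres_eq.trans)
qed

lemma mult_pres_class:
  "pres_class R u \<otimes>\<^bsub>presented_group R\<^esub> pres_class R v = pres_class R (u @ v)"
  unfolding presented_group_def
  by (auto simp: pres_class_def intro: pres_eq.intros pres_eq_append)
 
lemma group_presented_group: "group (presented_group R)"
proof (rule groupI)
  fix x assume "x \<in> carrier (presented_group R)"
  then obtain u where u: "x = pres_class R u" by (auto simp: presented_group_def)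
  have "pres_class R (inv_word u) \<otimes>\<^bsub>presented_group R\<^esub> x = \<one>\<^bsub>presented_group R\<^esub>"
    by (simp add: u mult_pres_class) 
       (simp add: presented_group_def pres_class_eq_iff pres_eq_inv_left)
  then show "\<exists>y\<in>carrier (presented_group R).
      y \<otimes>\<^bsub>presented_group R\<^esub> x = \<one>\<^bsub>presented_group R\<^esub>"
    by (auto simp: presented_group_def)
  show "\<one>\<^bsub>presented_group R\<^esub> \<otimes>\<^bsub>presented_group R\<^esub> x = x"
    using mult_pres_class[of R "[]" u] by (simp add: u presented_group_def)
next
  fix x y assume "x \<in> carrier (presented_group R)" "y \<in> carrier (presented_group R)"
  then obtain u v where "x = pres_class R u" "y = pres_class R v"
    by (auto simp: presented_group_def)
  then show "x \<otimes>\<^bsub>presented_group R\<^esub> y \<in> carrier (presented_group R)"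
    by (simp add: mult_pres_class) (simp add: presented_group_def)
next
  fix x y z
  assume "x \<in> carrier (presented_group R)" "y \<in> carrier (presented_group R)"
    "z \<in> carrier (presented_group R)"
  then obtain u v w where "x = pres_class R u" "y = pres_class R v" "z = pres_class R w"
    by (auto simp: presented_group_def)
  then show "x \<otimes>\<^bsub>presented_group R\<^esub> y \<otimes>\<^bsub>presented_group R\<^esub> z =
      x \<otimes>\<^bsub>presented_group R\<^esub> (y \<otimes>\<^bsub>presented_group R\<^esub> z)"
    by (simp add: mult_pres_class)
qed (simp add: presented_group_def)

lemma inv_pres_class:
  "inv\<^bsub>presented_group R\<^esub> pres_class R u = pres_class R (inv_word u)"
proof -
  interpret group "presented_group R" by (rule group_presented_group)
  have "pres_class R (inv_word u) \<otimes>\<^bsub>presented_group R\<^esub> pres_class R u = \<one>\<^bsub>presented_group R\<^esub>"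
    by (simp add: mult_pres_class)
       (simp add: presented_group_def pres_class_eq_iff pres_eq_inv_left)
  then show ?thesis
    by (intro inv_equality) (auto simp: presented_group_def)
qed

lemma generate_presented_group:
  "generate (presented_group R) (range (pres_gen R)) = carrier (presented_group R)"
proof
  interpret group "presented_group R" by (rule group_presented_group)
  show "generate (presented_group R) (range (pres_gen R)) \<subseteq> carrier (presented_group R)"
    by (rule generate_incl) (auto simp: presented_group_def pres_gen_def)
  have "pres_class R w \<in> generate (presented_group R) (range (pres_gen R))" for w
  proof (induction w)
    case Nil
    show ?case using generate.one[of "presented_group R"] by (simp add: presented_group_def)
  next
    case (Cons x w)
    obtain a b where x: "x = (a, b)" by (cases x)
    have "pres_class R [x] \<in> generate (presented_group R) (range (pres_gen R))"
    proof (cases b)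
      case True
      then show ?thesis by (auto simp: x pres_gen_def intro: generate.incl)
    next
      case False
      have "inv\<^bsub>presented_group R\<^esub> pres_gen R a \<in> generate (presented_group R) (range (pres_gen R))"
        by (rule generate.inv) simp
      then show ?thesis using False by (simp add: x pres_gen_def inv_pres_class inv_word_def)
    qed
    from generate.eng[OF this Cons.IH] show ?case by (simp add: mult_pres_class)
  qed
  then show "carrier (presented_group R) \<subseteq> generate (presented_group R) (range (pres_gen R))"
    by (auto simp: presented_group_def)
qed


section \<open>Thompson's group \<open>F\<close>\<close>

datatype thompson_gen = X0 | X1

text \<open>The convention for the commutator (\<open>u v u\<inverse> v\<inverse>\<close> or \<open>u\<inverse> v\<inverse> u v\<close>) does not affect the group,
  since either word being trivial says that \<open>u\<close> and \<open>v\<close> commute.\<close>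

definition thompson_relators :: "thompson_gen word set" where
  "thompson_relators =
    {commutator_word [(X0, True), (X1, False)] [(X0, False), (X1, True), (X0, True)],
     commutator_word [(X0, True), (X1, False)]
       [(X0, False), (X0, False), (X1, True), (X0, True), (X0, True)]}"

definition thompson_F :: "thompson_gen word set monoid" where
  "thompson_F = presented_group thompson_relators"

definition x0 :: "thompson_gen word set" where
  "x0 = pres_gen thompson_relators X0"

definition x1 :: "thompson_gen word set" where
  "x1 = pres_gen thompson_relators X1"

lemma group_thompson_F: "group thompson_F"
  by (simp add: thompson_F_def group_presented_group)

lemma generate_thompson_F: "generate thompson_F {x0, x1} = carrier thompson_F"
proof -
  have U: "(UNIV :: thompson_gen set) = {X0, X1}"
    by (auto intro: thompson_gen.exhaust)
  have "range (pres_gen thompson_relators) = {x0, x1}"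
    unfolding U x0_def x1_def by simp
  then show ?thesis
    using generate_presented_group[of thompson_relators] by (simp add: thompson_F_def)
qed


section \<open>Geodesics\<close>

text \<open>Words over \<open>X \<union> X\<inverse>\<close> are lists of group elements. For \<open>F\<close> and \<open>{x0, x1}\<close> this is the same as
  working with four formal letters, since \<open>x0\<close>, \<open>x1\<close> and their inverses are four distinct elements
  (see \<open>distinct_thompson_letters\<close> below).\<close>

definition sym_gens :: "('g, 'm) monoid_scheme \<Rightarrow> 'g set \<Rightarrow> 'g set" where
  "sym_gens G X = X \<union> m_inv G ` X"

definition word_value :: "('g, 'm) monoid_scheme \<Rightarrow> 'g list \<Rightarrow> 'g" where
  "word_value G w = foldr (\<otimes>\<^bsub>G\<^esub>) w \<one>\<^bsub>G\<^esub>"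

definition word_length :: "('g, 'm) monoid_scheme \<Rightarrow> 'g set \<Rightarrow> 'g \<Rightarrow> nat" where
  "word_length G X g =
    (LEAST n. \<exists>w \<in> lists (sym_gens G X). word_value G w = g \<and> length w = n)"

definition geodesic :: "('g, 'm) monoid_scheme \<Rightarrow> 'g set \<Rightarrow> 'g list \<Rightarrow> bool" where
  "geodesic G X w \<longleftrightarrow>
    w \<in> lists (sym_gens G X) \<and> length w = word_length G X (word_value G w)"

definition language_of_geodesics :: "('g, 'm) monoid_scheme \<Rightarrow> 'g set \<Rightarrow> 'g list set \<Rightarrow> bool" where
  "language_of_geodesics G X L \<longleftrightarrow>
    (\<forall>w\<in>L. geodesic G X w) \<and> (\<forall>g\<in>carrier G. \<exists>w\<in>L. word_value G w = g)"

lemma distinct_thompson_letters: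
  "distinct [x0, x1, inv\<^bsub>thompson_F\<^esub> x0, inv\<^bsub>thompson_F\<^esub> x1]"
proof -
  define e :: "thompson_gen \<Rightarrow> thompson_gen word \<Rightarrow> int" where
    "e = (\<lambda>g w. \<Sum>(a, b)\<leftarrow>w. if a = g then (if b then 1 else - 1) else 0)"
  have e: "e g u = e g v" if "pres_eq thompson_relators u v" for g u v
    using that
    by (induction rule: pres_eq.induct)
       (auto simp: e_def thompson_relators_def commutator_word_def inv_word_def)
  have "\<not> pres_eq thompson_relators u v" if "e g u \<noteq> e g v" for g u v
    using e that by blast
  from this[of X0] this[of X1] show ?thesis
    by (auto simp: thompson_F_def x0_def x1_def pres_gen_def inv_pres_class pres_class_eq_iff
        inv_word_def e_def)
qed


section \<open>Regular languages\<close>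

text \<open>Acceptance by a complete deterministic finite automaton over the alphabet \<open>A\<close>. Taking states
  in \<open>nat\<close> is no restriction, as every finite state set can be numbered.\<close>

record 'a dfa =
  states :: "nat set"
  start :: nat
  final :: "nat set"
  step :: "nat \<Rightarrow> 'a \<Rightarrow> nat"

definition is_dfa :: "'a set \<Rightarrow> 'a dfa \<Rightarrow> bool" where
  "is_dfa A M \<longleftrightarrow>
    finite A \<and> finite (states M) \<and> start M \<in> states M \<and> final M \<subseteq> states M \<and>
    (\<forall>q\<in>states M. \<forall>a\<in>A. step M q a \<in> states M)"

definition dfa_language :: "'a set \<Rightarrow> 'a dfa \<Rightarrow> 'a list set" where
  "dfa_language A M = {w \<in> lists A. foldl (step M) (start M) w \<in> final M}"

definition regular_language :: "'a set \<Rightarrow> 'a list set \<Rightarrow> bool" where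
  "regular_language A L \<longleftrightarrow> (\<exists>M. is_dfa A M \<and> L = dfa_language A M)"

end

theory Submission
  imports Defs Complex_Main
begin

text \<open>Let \<open>F\<close> act on the real line, with \<open>x0\<close> the translation by 1 and \<open>x1\<close> the identity on
  \<open>t \<le> 0\<close>, doubling on \<open>[0, 1]\<close> and translation by 1 on \<open>t \<ge> 1\<close>. Consider the element \<open>f\<close> that fixes
  0 and stretches exactly the intervals \<open>[-k, -k + 1]\<close> and \<open>[1, k + 1]\<close> by the factor 2. A word for
  \<open>f\<close> has to bring the points \<open>-k\<close> and \<open>k\<close> to the origin one after the other. Starting with either of
  them gives a word of length \<open>5k + 2\<close>, so both \<open>x0 f\<close> and the product of the inverse of \<open>x0\<close> with
  \<open>f\<close> are shorter than \<open>f\<close>. Conversely every geodesic word for \<open>f\<close> begins with the \<open>k\<close>-th power of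
  \<open>x0\<close> or of its inverse: contracting the line with the inverse of \<open>x1\<close> on the way costs as much as
  it saves, and the stretched intervals next to the origin make it impossible. If a regular language
  contains a geodesic for \<open>f\<close> and \<open>k\<close> is large, pumping the initial power gives a word in the
  language that is not geodesic.\<close>

section \<open>The action on the real line\<close>

type_synonym letter = "thompson_gen \<times> bool"

abbreviation up :: letter where "up \<equiv> (X0, True)"
abbreviation down :: letter where "down \<equiv> (X0, False)"
abbreviation stretch :: letter where "stretch \<equiv> (X1, True)"
abbreviation shrink :: letter where "shrink \<equiv> (X1, False)"

fun act :: "letter \<Rightarrow> real \<Rightarrow> real" where
  "act (X0, True) t = t + 1"
| "act (X0, False) t = t - 1"
| "act (X1, True) t = (if t \<le> 0 then t else if t \<le> 1 then 2 * t else t + 1)"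
| "act (X1, False) t = (if t \<le> 0 then t else if t \<le> 2 then t / 2 else t - 1)"

fun run :: "letter list \<Rightarrow> real \<Rightarrow> real" where
  "run [] t = t"
| "run (l # u) t = run u (act l t)"

lemma run_append [simp]: "run (u @ v) t = run v (run u t)"
  by (induction u arbitrary: t) auto

lemma letter_cases:
  obtains "l = up" | "l = down" | "l = stretch" | "l = shrink"
  by (cases l; cases "fst l"; cases "snd l") auto

lemma length_eq_sum_counts:
  "length u = count_list u up + count_list u down + count_list u stretch + count_list u shrink"
proof (induction u)
  case (Cons l u)
  then show ?case by (cases l rule: letter_cases) auto
qed simp

lemma eq_replicate_count: "(\<And>y. y \<in> set c \<Longrightarrow> y = x) \<Longrightarrow> c = replicate (count_list c x) x"
  by (induction c) auto

section \<open>Monotonicity and change of distances along a word\<close>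

lemma run_strict_mono: "s < t \<Longrightarrow> run u s < run u t"
proof (induction u arbitrary: s t)
  case (Cons l u)
  have "act l s < act l t"
    using Cons.prems by (cases l rule: letter_cases) auto
  then show ?case using Cons.IH by simp
qed simp

lemma run_mono: "s \<le> t \<Longrightarrow> run u s \<le> run u t"
  using run_strict_mono[of s t u] by (cases "s = t") auto

lemma run_replicate_up [simp]: "run (replicate n up) t = t + real n"
  by (induction n arbitrary: t) auto

lemma run_replicate_down [simp]: "run (replicate n down) t = t - real n"
  by (induction n arbitrary: t) auto

text \<open>\<open>shrink\<close> lowers a point by an amount that grows with the point from 0 to 1,
  so it takes at most 1 from a distance. No other letter decreases a distance.\<close>

lemma gap_ge:
  "s \<le> t \<Longrightarrow> run u t - run u s \<ge> t - s - real (count_list u shrink)"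
proof (induction u arbitrary: s t)
  case (Cons l u)
  have 1: "act l t - act l s \<ge> t - s - (if l = shrink then 1 else 0)" "act l s \<le> act l t"
    using Cons.prems by (cases l rule: letter_cases; simp add: field_simps)+
  from Cons.IH[OF 1(2)] 1(1) show ?case by (auto split: if_splits)
qed simp

text \<open>If \<open>gap_ge\<close> leaves no slack for the whole word, it leaves none for the
  parts before and after \<open>l\<close>, nor for \<open>l\<close> itself.\<close>

lemma gap_exact:
  assumes "s \<le> t" and u: "u = c @ l # d"
    and "run u t - run u s \<le> t - s - real (count_list u shrink)"
  shows "act l (run c t) - act l (run c s) \<le>
    run c t - run c s - (if l = shrink then 1 else 0)"
proof -
  have m: "run c s \<le> run c t" by (rule run_mono[OF assms(1)])
  then have m': "act l (run c s) \<le> act l (run c t)"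
    using run_mono[of "run c s" "run c t" "[l]"] by simp
  show ?thesis
    using gap_ge[OF assms(1), of c] gap_ge[OF m', of d] assms(3)
    by (auto simp: u split: if_splits)
qed

text \<open>A full unit is lost only if the lower point is not moved at all.\<close>

lemma gap_exact_shrink:
  assumes "s \<le> t" "u = c @ shrink # d"
    and "run u t - run u s \<le> t - s - real (count_list u shrink)"
  shows "run c s \<le> 0"
  using gap_exact[OF assms] run_mono[OF assms(1), of c] by (auto split: if_splits)

lemma gap_exact_stretch:
  assumes "s \<le> t" "u = c @ stretch # d"
    and "run u t - run u s \<le> t - s - real (count_list u shrink)"
  shows "\<not> (run c s \<le> 0 \<and> 0 < run c t)"
  using gap_exact[OF assms] by (auto split: if_splits)

section \<open>Displacement and the number of translations\<close>

lemma run_ge: "run u t \<ge> t - real (count_list u down) - real (count_list u shrink)"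
proof (induction u arbitrary: t)
  case (Cons l u)
  show ?case using Cons.IH[of "act l t"] by (cases l rule: letter_cases) (auto split: if_splits)
qed simp

text \<open>\<open>stretch\<close> and \<open>shrink\<close> fix the nonpositive points and keep
  positive points positive, so only translations change \<open>min t 0\<close>.\<close>

lemma min_run_le: "min (run u t) 0 \<le> min t 0 + real (count_list u up)"
proof (induction u arbitrary: t)
  case (Cons l u)
  show ?case using Cons.IH[of "act l t"]
    by (cases l rule: letter_cases) (auto simp: min_def split: if_splits)
qed simp

lemma min_run_ge: "min (run u t) 0 \<ge> min t 0 - real (count_list u down)"
proof (induction u arbitrary: t)
  case (Cons l u)
  show ?case using Cons.IH[of "act l t"]
    by (cases l rule: letter_cases) (auto simp: min_def split: if_splits)
qed simp

lemma run_nonpos: "up \<notin> set u \<Longrightarrow> t \<le> 0 \<Longrightarrow> run u t \<le> 0"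
proof (induction u arbitrary: t)
  case (Cons l u)
  then show ?case by (cases l rule: letter_cases) auto
qed simp

lemma run_neg: "up \<notin> set u \<Longrightarrow> t < 0 \<Longrightarrow> run u t < 0"
proof (induction u arbitrary: t)
  case (Cons l u)
  then show ?case by (cases l rule: letter_cases) auto
qed simp

lemma run_increasing:
  "down \<notin> set u \<Longrightarrow> shrink \<notin> set u \<Longrightarrow> t \<le> run u t"
proof (induction u arbitrary: t)
  case (Cons l u)
  have "t \<le> act l t"
    using Cons.prems by (cases l rule: letter_cases) auto
  also have "\<dots> \<le> run u (act l t)" using Cons by simp
  finally show ?case by simp
qed simp

lemma gap_rigid:
  assumes "s \<le> t" "\<And>c d. u = c @ d \<Longrightarrow> run c t \<le> 0"
  shows "run u t - run u s = t - s"
  using assms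
proof (induction u arbitrary: s t)
  case (Cons l u)
  have 0: "t \<le> 0" using Cons.prems(2)[of "[]"] by simp
  have eq: "act l t - act l s = t - s"
    using 0 Cons.prems(1) by (cases l rule: letter_cases) auto
  have "run u (act l t) - run u (act l s) = act l t - act l s"
  proof (rule Cons.IH)
    show "act l s \<le> act l t" using eq Cons.prems(1) by simp
    show "run c (act l t) \<le> 0" if "u = c @ d" for c d
      using Cons.prems(2)[of "l # c" d] that by simp
  qed
  then show ?case using eq by simp
qed simp

section \<open>Visits to the origin forced by a change of length\<close>

lemma first_prefix:
  assumes "u = c @ d" "P c"
  obtains v w where "u = v @ w" "P v" "\<And>c d. v = c @ d \<Longrightarrow> d \<noteq> [] \<Longrightarrow> \<not> P c"
proof -
  define n where "n = (LEAST n. P (take n u))"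
  have "P (take (length c) u)" using assms by simp
  then have n: "P (take n u)" unfolding n_def by (rule LeastI)
  have "\<not> P c" if cd: "take n u = c @ d" "d \<noteq> []" for c d
  proof
    assume "P c"
    have l: "length c < length (take n u)" using cd by simp
    have "take (length c) (take n u) = c" using cd by simp
    moreover have "length c \<le> n" using l by simp
    ultimately have "take (length c) u = c" by (simp add: min_absorb1)
    with \<open>P c\<close> have "n \<le> length c" unfolding n_def by (intro Least_le) simp
    with l show False by simp
  qed
  with n that[of "take n u" "drop n u"] show ?thesis by simp
qed

text \<open>As \<open>p\<close> is an integer, \<open>p < 0\<close> puts all of
  \<open>[p, p + 1]\<close> to the left of the origin or up to it, where every letter is a
  translation or the identity.\<close>

lemma visits_nonneg:
  assumes "run u (of_int p + 1) - run u (of_int p) \<noteq> 1"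
  shows "\<exists>c d. u = c @ d \<and> 0 \<le> run c (of_int p)"
  using assms
proof (induction u arbitrary: p)
  case (Cons l u)
  show ?case
  proof (cases "p \<ge> 0")
    case True
    then show ?thesis by (auto intro: exI[of _ "[]"])
  next
    case False
    then have "p + 1 \<le> 0" by simp
    then have p: "of_int p + 1 \<le> (0::real)" by linarith
    obtain p' :: int where "act l (of_int p) = of_int p'" "act l (of_int p + 1) = of_int p' + 1"
    proof (cases l rule: letter_cases)
      case 1 then show ?thesis using that[of "p + 1"] by simp
    next
      case 2 then show ?thesis using that[of "p - 1"] by simp
    qed (use p that[of p] in simp_all)
    with Cons.IH[of p'] Cons.prems obtain c d where "u = c @ d" "0 \<le> run c (act l (of_int p))"
      by auto
    then have "l # u = (l # c) @ d \<and> 0 \<le> run (l # c) (of_int p)" by simp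
    then show ?thesis by blast
  qed
qed simp

text \<open>As long as the image of \<open>s\<close> stays positive, \<open>[s, t]\<close> remains a standard dyadic interval,
  hence of length at most 1.\<close>

lemma visits_nonpos_dyadic:
  assumes "s = real m / 2 ^ i" "t = real (m + 1) / 2 ^ i" "run u t - run u s > 1"
  shows "\<exists>c d. u = c @ d \<and> run c s \<le> 0"
  using assms
proof (induction u arbitrary: s t m i)
  case Nil
  have "t - s = 1 / 2 ^ i" using Nil by (simp add: field_simps)
  also have "\<dots> \<le> 1" by simp
  finally show ?case using Nil by simp
next
  case (Cons l u)
  show ?case
  proof (cases "s \<le> 0")
    case True
    then show ?thesis by (auto intro: exI[of _ "[]"])
  next
    case False
    then have m: "m > 0" using Cons.prems(1) by (cases m) auto
    have lift: ?thesis if "\<exists>c d. u = c @ d \<and> run c (act l s) \<le> 0"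
      using that by (metis append_Cons run.simps(2))
    have r: "run u (act l t) - run u (act l s) > 1" using Cons.prems(3) by simp
    show ?thesis
    proof (cases l rule: letter_cases)
      case 1
      show ?thesis
        by (rule lift, rule Cons.IH[OF _ _ r, of "m + 2 ^ i" i])
          (simp_all add: 1 Cons.prems(1,2) field_simps)
    next
      case 2
      show ?thesis
      proof (cases "s \<le> 1")
        case True
        then have "l # u = [down] @ u \<and> run [down] s \<le> 0" using 2 by simp
        then show ?thesis by blast
      next
        case False
        then have "2 ^ i < real m" using Cons.prems(1) by (simp add: field_simps)
        then have "real (2 ^ i) \<le> real m" by simp
        then have "2 ^ i \<le> m" by (simp only: of_nat_le_iff)
        then show ?thesis
          by (intro lift Cons.IH[OF _ _ r, of "m - 2 ^ i" i])
            (simp_all add: 2 Cons.prems(1,2) field_simps of_nat_diff)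
      qed
    next
      case 3
      show ?thesis
      proof (cases "m < 2 ^ i")
        case True
        \<comment> \<open>From \<open>0 < m\<close> and \<open>m < 2 ^ i\<close> the exponent is
          positive and can absorb the doubling.\<close>
        then obtain j where j: "i = Suc j" using m by (cases i) auto
        have "real (m + 1) \<le> 2 ^ i"
          using of_nat_mono[OF Suc_leI[OF True], where 'a = real] by simp
        then have "t \<le> 1" "s \<le> 1" "0 < s" "0 < t"
          unfolding Cons.prems(1,2) using m True by (simp_all add: field_simps)
        then show ?thesis
          by (intro lift Cons.IH[OF _ _ r, of m j]) (simp_all add: 3 Cons.prems(1,2) j field_simps)
      next
        case False
        then have "real m \<ge> 2 ^ i"
          using of_nat_mono[of "2 ^ i" m, where 'a = real] by simp
        moreover from this have "2 ^ i < 1 + real m" by linarith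
        ultimately have "s \<ge> 1" "t > 1"
          unfolding Cons.prems(1,2) by (simp_all add: field_simps)
        then show ?thesis
          by (intro lift Cons.IH[OF _ _ r, of "m + 2 ^ i" i])
            (auto simp add: 3 Cons.prems(1,2) field_simps)
      qed
    next
      case 4
      show ?thesis
      proof (cases "m < 2 * 2 ^ i")
        case True
        have "real (m + 1) \<le> 2 * 2 ^ i"
          using of_nat_mono[OF Suc_leI[OF True], where 'a = real] by simp
        then have "t \<le> 2" "s \<le> 2" "0 < s" "0 < t"
          unfolding Cons.prems(1,2) using m True by (simp_all add: field_simps)
        then show ?thesis
          by (intro lift Cons.IH[OF _ _ r, of m "Suc i"])
            (simp_all add: 4 Cons.prems(1,2) field_simps)
      next
        case False
        then have g: "2 * 2 ^ i \<le> m" by simp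
        then have "real m \<ge> 2 * 2 ^ i"
          using of_nat_mono[OF g, where 'a = real] by simp
        then have "s \<ge> 2" "t > 2"
          unfolding Cons.prems(1,2) by (simp_all add: field_simps)
        moreover have "2 ^ i \<le> m" using g by simp
        moreover note m
        ultimately show ?thesis
          by (intro lift Cons.IH[OF _ _ r, of "m - 2 ^ i" i])
            (auto simp add: 4 Cons.prems(1,2) field_simps of_nat_diff)
      qed
    qed
  qed
qed

lemma visits_nonpos:
  "run u (real r + 1) - run u (real r) > 1 \<Longrightarrow> \<exists>c d. u = c @ d \<and> run c (real r) \<le> 0"
  using visits_nonpos_dyadic[of "real r" r 0 "real r + 1" u] by (simp add: add.commute)


section \<open>A shrunk pair of unit intervals\<close>

text \<open>The points \<open>w, y, z\<close> are the images of \<open>x\<close>, \<open>x + 1\<close>, \<open>x + 2\<close> after a letter \<open>shrink\<close> has been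
  applied with \<open>x\<close> at the origin. Once they are \<open>separated\<close>, only \<open>shrink\<close> or moving
  \<open>w\<close> below the origin could lead to a change of the distance of \<open>y\<close> and \<open>z\<close>.\<close>

definition shrunk :: "real \<Rightarrow> real \<Rightarrow> real \<Rightarrow> bool" where
  "shrunk w y z \<longleftrightarrow>
    (\<exists>(i::int) (m::nat). w = of_int i \<and> y = of_int i + 1 / 2 ^ Suc m \<and> z = of_int i + 1 / 2 ^ m)"

definition separated :: "real \<Rightarrow> real \<Rightarrow> real \<Rightarrow> bool" where
  "separated w y z \<longleftrightarrow> 0 \<le> w \<and> w + 1 \<le> y \<and> y < z \<and> z - y \<le> 1"

lemma shrunk_gap: "shrunk w y z \<or> separated w y z \<Longrightarrow> z - y \<le> 1"
proof -
  have "1 / 2 ^ m - 1 / 2 ^ Suc m \<le> (1::real)" for m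
    using power_increasing[of 0 "Suc m" "2::real"] by (simp add: field_simps)
  then show "shrunk w y z \<or> separated w y z \<Longrightarrow> z - y \<le> 1"
    by (auto simp: shrunk_def separated_def)
qed

lemma shrunk_act:
  assumes "shrunk w y z" "l = shrink \<Longrightarrow> w \<le> 0" "l = stretch \<Longrightarrow> w \<noteq> 0"
  shows "shrunk (act l w) (act l y) (act l z)"
proof -
  obtain i :: int and m :: nat
    where e: "w = of_int i" "y = of_int i + 1 / 2 ^ Suc m" "z = of_int i + 1 / 2 ^ m"
    using assms(1) by (auto simp: shrunk_def)
  define h :: real where "h = 1 / 2 ^ m"
  have h: "0 < h" "h \<le> 1" "y = of_int i + h / 2" "z = of_int i + h"
    by (simp_all add: e h_def)
  note I = shrunk_def[THEN iffD2]
  show ?thesis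
  proof (cases l rule: letter_cases)
    case 1
    show ?thesis by (rule I, rule exI[of _ "i + 1"], rule exI[of _ m]) (simp add: 1 e)
  next
    case 2
    show ?thesis by (rule I, rule exI[of _ "i - 1"], rule exI[of _ m]) (simp add: 2 e)
  next
    case 3
    then consider "i \<le> -1" | "i \<ge> 1" using assms(3) e(1) by fastforce
    then show ?thesis
    proof cases
      case a: 1
      then have "of_int i \<le> (-1::real)" by linarith
      then have "w \<le> 0" "y \<le> 0" "z \<le> 0" using e(1) h by linarith+
      then show ?thesis using 3 assms(1) by simp
    next
      case a: 2
      then have "of_int i \<ge> (1::real)" by linarith
      then have "w \<ge> 1" "y > 1" "z > 1" using e(1) h by linarith+
      then show ?thesis
        by (intro I exI[of _ "i + 1"] exI[of _ m]) (use 3 e in auto)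
    qed
  next
    case 4
    then have "i \<le> 0" using assms(2) e(1) by simp
    then consider "i \<le> -1" | "i = 0" by linarith
    then show ?thesis
    proof cases
      case a: 1
      then have "of_int i \<le> (-1::real)" by linarith
      then have "w \<le> 0" "y \<le> 0" "z \<le> 0" using e(1) h by linarith+
      then show ?thesis using 4 assms(1) by simp
    next
      case a: 2
      then have "w = 0" "0 < y" "y \<le> 2" "0 < z" "z \<le> 2" using e(1) h by auto
      then have "act l w = 0" "act l y = y / 2" "act l z = z / 2" using 4 by simp_all
      then show ?thesis
        by (intro I exI[of _ "0::int"] exI[of _ "Suc m"]) (simp add: e a)
    qed
  qed
qed

lemma shrunk_run:
  assumes "shrunk w y z"
    and "\<And>c d. u = c @ shrink # d \<Longrightarrow> run c w \<le> 0"
    and "\<And>c d. u = c @ stretch # d \<Longrightarrow> run c w \<noteq> 0"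
  shows "shrunk (run u w) (run u y) (run u z)"
  using assms
proof (induction u arbitrary: w y z)
  case (Cons l u)
  have "shrunk (act l w) (act l y) (act l z)"
    by (rule shrunk_act) (use Cons.prems(1) Cons.prems(2,3)[of "[]"] in auto)
  then have "shrunk (run u (act l w)) (run u (act l y)) (run u (act l z))"
    by (rule Cons.IH) (use Cons.prems(2,3)[of "l # c" for c] in auto)
  then show ?case by simp
qed simp

text \<open>Without \<open>shrink\<close>, a shrunk triple opens only by \<open>stretch\<close> at
  \<open>w = 0\<close>, \<open>m = 0\<close>, which gives 0, 1, 2. From then on \<open>y\<close> and
  \<open>z\<close> are at least 1 and move alike, provided that \<open>w\<close> is not brought
  below the origin.\<close>

lemma shrunk_or_separated_act:
  assumes "shrunk w y z \<or> separated w y z" "l \<noteq> shrink" "l = down \<Longrightarrow> 1 \<le> w"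
  shows "shrunk (act l w) (act l y) (act l z) \<or> separated (act l w) (act l y) (act l z)"
proof (cases "separated w y z")
  case True
  then show ?thesis using assms(2,3)
    by (cases l rule: letter_cases) (auto simp: separated_def)
next
  case False
  with assms(1) have s: "shrunk w y z" by simp
  show ?thesis
  proof (cases "l = stretch \<and> w = 0")
    case False
    then show ?thesis using shrunk_act[OF s, of l] assms(2) by auto
  next
    case True
    obtain i :: int and m :: nat
      where e: "w = of_int i" "y = of_int i + 1 / 2 ^ Suc m" "z = of_int i + 1 / 2 ^ m"
      using s by (auto simp: shrunk_def)
    have i: "i = 0" using True e(1) by simp
    show ?thesis
    proof (cases m)
      case 0
      then show ?thesis using True e i by (simp add: separated_def)
    next
      case (Suc n)
      have "1 / (2::real) ^ m \<le> 1" "1 / (2::real) ^ Suc m \<le> 1"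
        by (simp_all add: one_le_power del: power_Suc)
      moreover have "0 < y" "0 < z" using e i by simp_all
      ultimately have "act stretch y = 2 * y" "act stretch z = 2 * z"
        using e i by simp_all
      then have "shrunk (act l w) (act l y) (act l z)"
        unfolding shrunk_def
        by (intro exI[of _ "0::int"] exI[of _ n]) (use True e i Suc in auto)
      then show ?thesis ..
    qed
  qed
qed

lemma shrunk_or_separated_run:
  assumes "shrunk w y z \<or> separated w y z" "shrink \<notin> set u"
    and "\<And>c d. u = c @ down # d \<Longrightarrow> 1 \<le> run c w"
  shows "shrunk (run u w) (run u y) (run u z) \<or> separated (run u w) (run u y) (run u z)"
  using assms
proof (induction u arbitrary: w y z)
  case (Cons l u)
  have "shrunk (act l w) (act l y) (act l z) \<or> separated (act l w) (act l y) (act l z)"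
    by (rule shrunk_or_separated_act) (use Cons.prems(1,2) Cons.prems(3)[of "[]"] in auto)
  then have "shrunk (run u (act l w)) (run u (act l y)) (run u (act l z))
      \<or> separated (run u (act l w)) (run u (act l y)) (run u (act l z))"
    by (rule Cons.IH) (use Cons.prems(2) Cons.prems(3)[of "l # c" for c] in auto)
  then show ?case by simp
qed simp

section \<open>Words with two distant visits\<close>

text \<open>Apart from the length bound, these are properties of the element \<open>f\<close>:
  values of its action and, in \<open>exponent\<close>, the exponent sum of
  \<open>x1\<close>.\<close>

locale seesaw_word =
  fixes k :: nat and u :: "letter list"
  assumes k: "4 \<le> k"
    and left_end: "run u (- real k) = - real k - 1"
    and left_end_succ: "run u (1 - real k) = 1 - real k"
    and origin: "run u 0 = 0"
    and doubled: "s < k \<Longrightarrow> run u (real s + 2) - run u (real s + 1) = 2"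
    and exponent: "count_list u stretch = count_list u shrink + k + 1"
    and length_le: "length u \<le> 5 * k + 2"
begin

text \<open>By \<open>exponent\<close>, every \<open>shrink\<close> entails a further
  \<open>stretch\<close>, so it is charged like two translations.\<close>

lemma count_up_down:
  "count_list u up + count_list u down + 2 * count_list u shrink \<le> 4 * k + 1"
  using length_le exponent length_eq_sum_counts[of u] by linarith

lemma length_eqI:
  "count_list u up + count_list u down + 2 * count_list u shrink \<ge> 4 * k + 1 \<Longrightarrow>
    length u = 5 * k + 2"
  using length_le exponent length_eq_sum_counts[of u] by linarith

text \<open>The word is cut where \<open>k\<close> first reaches the origin and where \<open>-k\<close> does afterwards. The bounds on
  the number of translations in the three pieces add up to the bound of \<open>count_up_down\<close>, so all of
  them are attained, which determines the letters allowed in each piece.\<close>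

lemma right_first:
  assumes u: "u = u1 @ u2 @ u3"
    and right: "run u1 (real k) \<le> 0"
    and first: "\<And>c d. u1 = c @ d \<Longrightarrow> d \<noteq> [] \<Longrightarrow> 0 < run c (real k)"
    and left: "0 \<le> run (u1 @ u2) (- real k)"
  shows "length u = 5 * k + 2 \<and> (\<exists>v. u = replicate k down @ v)"
proof -
  have A1: "real k \<le> real (count_list u1 down) + real (count_list u1 shrink)"
    using run_ge[of "real k" u1] right by linarith
  \<comment> \<open>A \<open>shrink\<close> in \<open>u1\<close> saves one \<open>down\<close> for
    \<open>k\<close> in the bound above and one \<open>up\<close> for \<open>-k\<close> here:
    together just what it costs in \<open>count_up_down\<close>.\<close>
  have "run u1 (- real k) \<le> - (2 * real k - real (count_list u1 shrink))"
    using gap_ge[of "- real k" "real k" u1] right by linarith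
  then have a2: "2 * real k - real (count_list u1 shrink) \<le> real (count_list u2 up)"
    using min_run_le[of u2 "run u1 (- real k)"] left by simp
  have A3: "real k + 1 \<le> real (count_list u3 down)"
    using min_run_ge[of "run (u1 @ u2) (- real k)" u3] left left_end u by simp
  note counts = count_up_down[unfolded u count_list_append]
  have bounds: "k \<le> count_list u1 down + count_list u1 shrink"
    "2 * k \<le> count_list u2 up + count_list u1 shrink" "k + 1 \<le> count_list u3 down"
    using A1 a2 A3 by linarith+
  have len: "length u = 5 * k + 2"
    by (rule length_eqI) (use bounds in \<open>simp add: u\<close>)
  let ?m = "count_list u1 down + count_list u2 up + count_list u3 down + 2 * count_list u1 shrink"
  have m: "4 * k + 1 \<le> ?m" using bounds by linarith
  have "?m + (count_list u1 up + count_list u2 down + count_list u2 shrink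
      + count_list u3 up + count_list u3 shrink) \<le> 4 * k + 1"
    using counts by simp
  with m have z: "count_list u1 up = 0" "count_list u2 down = 0"
    "count_list u2 shrink = 0" "count_list u3 up = 0" "count_list u3 shrink = 0"
    "count_list u1 down + count_list u1 shrink = k"
    using bounds by linarith+
  have no: "up \<notin> set u1" "down \<notin> set u2" "shrink \<notin> set u2" "up \<notin> set u3" "shrink \<notin> set u3"
    using z by (simp_all add: count_list_0_iff)
  \<comment> \<open>A \<open>stretch\<close> would push the still positive image of \<open>k\<close>
    upwards, and the \<open>k\<close> letters \<open>down\<close> and \<open>shrink\<close> of
    \<open>u1\<close> could no longer bring it to the origin.\<close>
  have no_stretch: "stretch \<notin> set u1"
  proof
    assume "stretch \<in> set u1"
    then obtain c d where cd: "u1 = c @ stretch # d" by (auto dest: split_list)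
    have "0 < run c (real k)" using first[OF cd] by simp
    then have "run c (real k) < act stretch (run c (real k))" by simp
    then have "0 < run u1 (real k)"
      using run_ge[of "real k" c] run_ge[of "act stretch (run c (real k))" d] z(6) by (simp add: cd)
    with right show False by simp
  qed
  have only_down: "c = replicate (count_list c down) down"
    if "set c \<subseteq> set u1" "shrink \<notin> set c" for c
  proof (rule eq_replicate_count)
    fix l assume "l \<in> set c"
    then show "l = down" using that no(1) no_stretch by (cases l rule: letter_cases) auto
  qed
  have "shrink \<notin> set u1"
  proof
    assume "shrink \<in> set u1"
    then obtain c d where cd: "u1 = c @ shrink # d" "shrink \<notin> set c"
      by (metis split_list_first)
    \<comment> \<open>The first \<open>shrink\<close> finds \<open>s\<close> at the origin and turns
      \<open>s, s + 1, s + 2\<close> into 0, 1/2, 1. The distance of the last two points then ends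
      up at most 1, against \<open>doubled\<close>.\<close>
    define s where "s = count_list c down"
    have c: "c = replicate s down" unfolding s_def by (rule only_down) (use cd in auto)
    have "s < k" using z(6) by (simp add: cd s_def)
    have shrunk: "shrunk (run (c @ [shrink]) s) (run (c @ [shrink]) (s + 1)) (run (c @ [shrink]) (s + 2))"
      unfolding shrunk_def by (rule exI[of _ "0::int"], rule exI[of _ 0]) (simp add: c)
    have "shrunk (run d (run (c @ [shrink]) s)) (run d (run (c @ [shrink]) (s + 1)))
        (run d (run (c @ [shrink]) (s + 2)))"
    proof (rule shrunk_run[OF shrunk])
      show "run c' (run (c @ [shrink]) s) \<le> 0" if "d = c' @ shrink # d'" for c' d'
        by (rule run_nonpos) (use no(1) cd that in \<open>auto simp: c\<close>)
      show "run c' (run (c @ [shrink]) s) \<noteq> 0" if "d = c' @ stretch # d'" for c' d'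
        using no_stretch that cd by simp
    qed
    then have "shrunk (run u1 s) (run u1 (s + 1)) (run u1 (s + 2))"
      by (simp add: cd del: act.simps)
    then have "shrunk (run u2 (run u1 s)) (run u2 (run u1 (s + 1))) (run u2 (run u1 (s + 2))) \<or>
        separated (run u2 (run u1 s)) (run u2 (run u1 (s + 1))) (run u2 (run u1 (s + 2)))"
      by (intro shrunk_or_separated_run disjI1) (use no in auto)
    then have "shrunk (run u3 (run u2 (run u1 s))) (run u3 (run u2 (run u1 (s + 1))))
        (run u3 (run u2 (run u1 (s + 2)))) \<or>
        separated (run u3 (run u2 (run u1 s))) (run u3 (run u2 (run u1 (s + 1))))
        (run u3 (run u2 (run u1 (s + 2))))"
    proof (rule shrunk_or_separated_run)
      show "shrink \<notin> set u3" by (fact no)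
      fix c' d' assume u3: "u3 = c' @ down # d'"
      \<comment> \<open>Without \<open>up\<close> in \<open>u3\<close>, a negative point stays
        negative; but the origin has to end at 0. The image of \<open>s\<close> lies no lower than
        that of the origin.\<close>
      have "0 \<le> run (c' @ [down]) (run u2 (run u1 0))"
      proof (rule ccontr)
        assume "\<not> ?thesis"
        then have "run d' (run (c' @ [down]) (run u2 (run u1 0))) < 0"
          by (intro run_neg[of d']) (use no u3 in auto)
        with origin show False by (simp add: u u3)
      qed
      moreover have "run c' (run u2 (run u1 0)) \<le> run c' (run u2 (run u1 s))"
        by (intro run_mono) simp
      ultimately show "1 \<le> run c' (run u2 (run u1 s))" by simp
    qed
    then show False using shrunk_gap doubled[OF \<open>s < k\<close>] by (fastforce simp: u add.commute)
  qed
  then have "count_list u1 down = k" using z(6) by simp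
  moreover have "u1 = replicate (count_list u1 down) down"
    by (rule only_down) (use \<open>shrink \<notin> set u1\<close> in auto)
  ultimately have "u1 = replicate k down" by metis
  then show ?thesis using len u by blast
qed

text \<open>After \<open>k\<close> has reached the origin, \<open>-k\<close> does not, so it was
  there before, at the end of a prefix \<open>u1\<close> of \<open>v\<close>. With \<open>?B\<close>
  letters \<open>shrink\<close> in \<open>v\<close>, the three pieces need \<open>k\<close>,
  \<open>2k + 1 - ?B\<close> and \<open>k - ?B\<close> translations, which again exhausts
  \<open>count_up_down\<close>.\<close>

lemma left_first:
  assumes u: "u = v @ u3"
    and right: "run v (real k) \<le> 0"
    and first: "\<And>c d. v = c @ d \<Longrightarrow> d \<noteq> [] \<Longrightarrow> 0 < run c (real k)"
    and no_left: "\<And>c d. u3 = c @ d \<Longrightarrow> run (v @ c) (- real k) < 0"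
  shows "length u = 5 * k + 2 \<and> (\<exists>v. u = replicate k up @ v)"
proof -
  have "\<exists>c d. u = c @ d \<and> 0 \<le> run c (of_int (- int k))"
    by (rule visits_nonneg) (use left_end left_end_succ in \<open>simp add: add.commute\<close>)
  then obtain c d where cd: "u = c @ d" "0 \<le> run c (- real k)" by auto
  have "\<exists>e. v = c @ e"
    using cd u no_left by (metis append_eq_append_conv2 not_less)
  then obtain e where "v = c @ e" by blast
  from first_prefix[of v c e "\<lambda>c. 0 \<le> run c (- real k)", OF this cd(2)]
  obtain u1 u2 where v: "v = u1 @ u2" and left: "0 \<le> run u1 (- real k)"
    and before: "\<And>c d. u1 = c @ d \<Longrightarrow> d \<noteq> [] \<Longrightarrow> run c (- real k) < 0"
    by (metis not_less)
  let ?B = "real (count_list v shrink)"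
  have a1: "k \<le> count_list u1 up"
    using min_run_le[of u1 "- real k"] left by simp
  have gap: "run v (real k) - run v (1 - real k) \<ge> 2 * real k - 1 - ?B"
    using gap_ge[of "1 - real k" "real k" v] k by simp
  have lt: "run v (- real k) < run v (1 - real k)" by (rule run_strict_mono) simp
  have A2': "- run v (- real k) \<le> real (count_list u2 down)"
    using min_run_ge[of "run u1 (- real k)" u2] left no_left[of "[]"] by (simp add: v)
  note counts = count_up_down[unfolded u v count_list_append]
  have B: "count_list v shrink = count_list u1 shrink + count_list u2 shrink" by (simp add: v)
  \<comment> \<open>Crossing the origin would take at least \<open>2k - 1 - ?B\<close> letters
    \<open>up\<close>, besides as many \<open>down\<close> in \<open>u2\<close> and \<open>k\<close>
    letters \<open>up\<close> in \<open>u1\<close>. With each \<open>shrink\<close> counted twice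
    this gives \<open>5k - 2\<close>, too much for \<open>k \<ge> 4\<close>.\<close>
  have rigid: "run (v @ c) (1 - real k) \<le> 0" if c: "u3 = c @ d" for c d
  proof (rule ccontr)
    assume pos: "\<not> ?thesis"
    have "2 * real k - 1 - ?B \<le> real (count_list c up)"
      using min_run_le[of c "run v (1 - real k)"] pos gap right by simp
    then have "2 * k \<le> count_list c up + count_list v shrink + 1"
      "2 * k \<le> count_list u2 down + count_list v shrink + 1"
      using A2' gap right lt by linarith+
    then show False
      using counts a1 k B by (simp add: c)
  qed
  \<comment> \<open>So \<open>u3\<close> moves \<open>[-k, 1 - k]\<close> rigidly, and its doubling
    is complete after \<open>v\<close>.\<close>
  have "run u3 (run v (1 - real k)) - run u3 (run v (- real k)) =
      run v (1 - real k) - run v (- real k)"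
    by (rule gap_rigid) (use lt rigid in auto)
  then have two: "run v (1 - real k) - run v (- real k) = 2"
    using left_end left_end_succ by (simp add: u)
  have A2: "2 * real k + 1 - ?B \<le> real (count_list u2 down)"
    using A2' gap right two by linarith
  have a3: "real k - ?B \<le> real (count_list u3 up)"
    using min_run_ge[of "run v (- real k)" u3] min_run_le[of u3 "run v (- real k)"]
      left_end gap right two by (simp add: u)
  have bounds: "2 * k + 1 \<le> count_list u2 down + count_list v shrink"
    "k \<le> count_list u3 up + count_list v shrink"
    using A2 a3 by linarith+
  let ?m = "count_list u1 up + count_list u2 down + count_list u3 up + 2 * count_list v shrink"
  have m: "4 * k + 1 \<le> ?m" using bounds a1 by linarith
  have "?m + (count_list u1 down + count_list u3 down + count_list u3 shrink) \<le> 4 * k + 1"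
    using counts B by simp
  with m have z: "count_list u1 down = 0" "count_list u3 down = 0"
    "count_list u3 shrink = 0" "count_list u1 up = k"
    "count_list u2 down + count_list v shrink = 2 * k + 1"
    using a1 bounds by linarith+
  then have no: "down \<notin> set u1" "down \<notin> set u3" "shrink \<notin> set u3"
    by (simp_all add: count_list_0_iff)
  have len: "length u = 5 * k + 2"
    by (rule length_eqI) (use a1 bounds in \<open>simp add: u v\<close>)
  \<comment> \<open>Before the origin is reached by \<open>k\<close>, every letter changes the distances from \<open>k\<close> to \<open>1 - k\<close> and
    to \<open>0\<close> by the least possible amount.\<close>
  have exact: "run v (real k) - run v (1 - real k) \<le> real k - (1 - real k) - ?B"
    using A2' z(5) two right by linarith
  \<comment> \<open>\<open>u3\<close> consists of \<open>up\<close> and \<open>stretch\<close> and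
    lowers no point, yet the origin ends at 0. Hence \<open>u3\<close> is rigid between
    \<open>1 - k\<close> and 0 as well, which turns \<open>exact\<close> into
    \<open>exact'\<close>.\<close>
  have origin_nonpos: "run c (run v 0) \<le> 0" if "u3 = c @ d" for c d
    using run_increasing[of d "run c (run v 0)"] no origin by (auto simp: u that)
  have "run u3 (run v 0) - run u3 (run v (1 - real k)) = run v 0 - run v (1 - real k)"
    by (rule gap_rigid) (use origin_nonpos run_mono[of "1 - real k" 0 v] k in auto)
  then have exact': "run v (real k) - run v 0 \<le> real k - 0 - ?B"
    using exact origin left_end_succ by (simp add: u)
  have "l = up" if "l \<in> set u1" for l
  proof (rule ccontr)
    assume "l \<noteq> up"
    with that obtain c l d where cd: "u1 = c @ l # d" "l \<noteq> up" "\<forall>y\<in>set c. y = up"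
      using split_list_first_prop[of u1 "\<lambda>l. l \<noteq> up"] by blast
    define s where "s = count_list c up"
    have c: "c = replicate s up" unfolding s_def by (rule eq_replicate_count) (use cd in blast)
    have "s < k" using before[OF cd(1)] by (simp add: c)
    have v': "v = c @ l # (d @ u2)" by (simp add: v cd)
    show False
    proof (cases l rule: letter_cases)
      case 3
      then show False
        using gap_exact_stretch[OF _ v'[unfolded 3] exact] \<open>s < k\<close> k by (simp add: c)
    next
      case 4
      \<comment> \<open>\<open>exact'\<close> admits \<open>shrink\<close> only while the image
        \<open>s\<close> of 0 is at the origin, that is, as the very first letter. It makes 0, 1, 2
        a shrunk triple, so that \<open>[1, 2]\<close> cannot be doubled.\<close>
      have "s = 0" using gap_exact_shrink[OF _ v'[unfolded 4] exact'] by (simp add: c)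
      then have v'': "v = shrink # (d @ u2)" using v' 4 c by simp
      have "shrunk (run (d @ u2) 0) (run (d @ u2) (1 / 2)) (run (d @ u2) 1)"
      proof (rule shrunk_run)
        show "shrunk 0 (1 / 2) 1"
          unfolding shrunk_def by (rule exI[of _ "0::int"], rule exI[of _ 0]) simp
        show "run c' 0 \<le> 0" if "d @ u2 = c' @ shrink # d'" for c' d'
          using gap_exact_shrink[OF _ _ exact', of "shrink # c'" d'] that by (simp add: v'')
        show "run c' 0 \<noteq> 0" if "d @ u2 = c' @ stretch # d'" for c' d'
          using gap_exact_stretch[OF _ _ exact', of "shrink # c'" d'] that
            run_strict_mono[of 0 "real k" "shrink # c'"] k by (auto simp: v'')
      qed
      then have "shrunk (run v 0) (run v 1) (run v 2)" by (simp add: v'')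
      then have "shrunk (run u3 (run v 0)) (run u3 (run v 1)) (run u3 (run v 2)) \<or>
          separated (run u3 (run v 0)) (run u3 (run v 1)) (run u3 (run v 2))"
        by (intro shrunk_or_separated_run disjI1) (use no in auto)
      then show False using shrunk_gap doubled[of 0] k by (fastforce simp: u)
    qed (use cd no in auto)
  qed
  then have "u1 = replicate (count_list u1 up) up" by (rule eq_replicate_count)
  then have "u1 = replicate k up" by (simp only: z(4))
  then have "u = replicate k up @ (u2 @ u3)" by (simp only: u v append_assoc)
  then show ?thesis using len by blast
qed

lemma begins_with_power:
  "length u = 5 * k + 2 \<and> (\<exists>x\<in>{up, down}. \<exists>v. u = replicate k x @ v)"
proof -
  \<comment> \<open>\<open>[k, k + 1]\<close> is the last of the stretched intervals, so
    \<open>k\<close> must come down to the origin. The cases differ in whether \<open>-k\<close>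
    reaches it afterwards.\<close>
  have "run u (real k + 1) - run u (real k) > 1"
    using doubled[of "k - 1"] k by (simp add: of_nat_diff add.commute)
  then obtain c d where "u = c @ d" "run c (real k) \<le> 0" by (blast dest: visits_nonpos)
  from first_prefix[of u c d "\<lambda>c. run c (real k) \<le> 0", OF this]
  obtain v w where vw: "u = v @ w" "run v (real k) \<le> 0"
    "\<And>c d. v = c @ d \<Longrightarrow> d \<noteq> [] \<Longrightarrow> 0 < run c (real k)"
    by (metis not_less)
  show ?thesis
  proof (cases "\<exists>c d. w = c @ d \<and> 0 \<le> run (v @ c) (- real k)")
    case True
    then obtain c d where "w = c @ d" "0 \<le> run (v @ c) (- real k)" by blast
    with right_first[of v c d] vw show ?thesis by auto
  next
    case False
    then have "\<And>c d. w = c @ d \<Longrightarrow> run (v @ c) (- real k) < 0" by (auto simp: not_le)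
    from left_first[OF vw this] show ?thesis by auto
  qed
qed

end

section \<open>Two spellings of the seesaw element\<close>

lemma run_pres_eq: "pres_eq thompson_relators u v \<Longrightarrow> run u t = run v t"
proof (induction arbitrary: t rule: pres_eq.induct)
  case (cancel u a b v)
  have "act (a, \<not> b) (act (a, b) s) = s" for s
    by (cases a; cases b) auto
  then show ?case by simp
next
  case (relator r u v)
  have "run r s = s" for s
    using relator
    by (auto simp: thompson_relators_def commutator_word_def inv_word_def field_simps)
  then show ?case by simp
qed simp_all

text \<open>The exponent sum of \<open>x1\<close> vanishes on both relators; the additive form
  avoids subtraction of naturals.\<close>

lemma exponent_pres_eq:
  "pres_eq thompson_relators u v \<Longrightarrow>
    count_list u stretch + count_list v shrink = count_list v stretch + count_list u shrink"
proof (induction rule: pres_eq.induct)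
  case (cancel u a b v)
  show ?case by (cases a; cases b) auto
qed (auto simp: thompson_relators_def commutator_word_def inv_word_def)

text \<open>Each round doubles the unit interval that starts at the origin and brings its left
  neighbour there.\<close>

definition staircase :: "nat \<Rightarrow> letter list" where
  "staircase k = concat (replicate k [stretch, up])"

text \<open>The intervals on the right are doubled first, then \<open>[-k, 1 - k]\<close>;
  \<open>seesaw'\<close> has the opposite order. The extra \<open>down\<close> undoes the shift that
  \<open>stretch\<close> causes beyond the doubled interval.\<close>

definition seesaw :: "nat \<Rightarrow> letter list" where
  "seesaw k = replicate k down @ staircase k @ replicate k up @ stretch # replicate (k + 1) down"

definition seesaw' :: "nat \<Rightarrow> letter list" where
  "seesaw' k = replicate k up @ (stretch # replicate (k + 1) down) @ replicate k down @ staircase k"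

lemma length_staircase [simp]: "length (staircase k) = 2 * k"
  by (induction k) (auto simp: staircase_def)

lemma count_staircase [simp]:
  "count_list (staircase k) stretch = k" "count_list (staircase k) shrink = 0"
  by (induction k) (auto simp: staircase_def)

lemma staircase_add: "staircase (m + n) = staircase m @ staircase n"
  by (simp add: staircase_def replicate_add)

lemma run_staircase_nonpos: "t + real k \<le> 0 \<Longrightarrow> run (staircase k) t = t + real k"
  by (induction k arbitrary: t) (auto simp: staircase_def)

lemma run_staircase_ge_1: "1 \<le> t \<Longrightarrow> run (staircase k) t = t + 2 * real k"
  by (induction k arbitrary: t) (auto simp: staircase_def)

text \<open>For \<open>i \<le> k\<close>, the first \<open>k - i\<close> rounds translate the point
  to 0, the next takes 0 to 1, and each of the remaining \<open>i - 1\<close> adds 2.\<close>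

lemma run_staircase:
  assumes "1 \<le> i" "i \<le> k + 1"
  shows "run (staircase k) (real i - real k) = 2 * real i - 1"
proof (cases "i = k + 1")
  case True
  then show ?thesis by (simp add: run_staircase_ge_1)
next
  case False
  then have i: "i \<le> k" using assms by simp
  obtain m where m: "i = Suc m" using assms by (cases i) auto
  have "run (staircase (k - i)) (real i - real k) = 0"
    using i by (simp add: run_staircase_nonpos of_nat_diff)
  moreover have "run (staircase i) 0 = run (staircase m) 1"
    by (simp add: m staircase_def)
  moreover have "staircase k = staircase (k - i) @ staircase i"
    using i by (simp flip: staircase_add)
  ultimately show ?thesis by (simp add: run_staircase_ge_1 m)
qed

lemma count_replicate_neq: "x \<noteq> y \<Longrightarrow> count_list (replicate n x) y = 0"
  by (simp add: count_list_0_iff)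

lemma seesaw_word_if_pres_eq:
  assumes "4 \<le> k" "pres_eq thompson_relators u (seesaw k)" "length u \<le> 5 * k + 2"
  shows "seesaw_word k u"
proof
  have run_u: "run u = run (seesaw k)" using run_pres_eq[OF assms(2)] by (rule ext)
  show "run u (- real k) = - real k - 1" "run u (1 - real k) = 1 - real k" "run u 0 = 0"
    using assms(1) by (simp_all add: run_u seesaw_def run_staircase_nonpos)
  show "run u (real s + 2) - run u (real s + 1) = 2" if "s < k" for s
    using run_staircase[of "s + 1" k] run_staircase[of "s + 2" k] that
    by (simp add: run_u seesaw_def add.commute)
  show "count_list u stretch = count_list u shrink + k + 1"
    using exponent_pres_eq[OF assms(2)] by (simp add: seesaw_def count_replicate_neq)
qed (use assms in auto)

section \<open>Commutation relations that follow from the two relators\<close>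

context group
begin

lemma l_inv_cancel: "a \<in> carrier G \<Longrightarrow> b \<in> carrier G \<Longrightarrow> inv a \<otimes> (a \<otimes> b) = b"
  by (simp flip: m_assoc)

lemma r_inv_cancel: "a \<in> carrier G \<Longrightarrow> b \<in> carrier G \<Longrightarrow> a \<otimes> (inv a \<otimes> b) = b"
  by (simp flip: m_assoc)

lemma commute_mult:
  assumes "c \<otimes> g = g \<otimes> c" "c \<otimes> h = h \<otimes> c"
    and "c \<in> carrier G" "g \<in> carrier G" "h \<in> carrier G"
  shows "c \<otimes> (g \<otimes> h) = g \<otimes> h \<otimes> c"
  using assms by (metis m_assoc)

lemma commute_inv:
  assumes "c \<otimes> g = g \<otimes> c" "c \<in> carrier G" "g \<in> carrier G"
  shows "c \<otimes> inv g = inv g \<otimes> c"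
  using assms by (metis inv_closed inv_solve_left inv_solve_right m_assoc m_closed)

lemma commute_conj:
  assumes "c \<otimes> (inv p \<otimes> g \<otimes> p) = inv p \<otimes> g \<otimes> p \<otimes> c"
    and cl: "c \<in> carrier G" "g \<in> carrier G" "p \<in> carrier G"
  shows "p \<otimes> c \<otimes> inv p \<otimes> g = g \<otimes> (p \<otimes> c \<otimes> inv p)"
proof -
  have "p \<otimes> c \<otimes> inv p \<otimes> g = p \<otimes> (c \<otimes> (inv p \<otimes> g \<otimes> p)) \<otimes> inv p"
    using cl by (simp add: m_assoc)
  also have "\<dots> = g \<otimes> (p \<otimes> c \<otimes> inv p)"
    unfolding assms(1) using cl by (simp add: m_assoc r_inv_cancel)
  finally show ?thesis .
qed

text \<open>This is the passage from two relators to infinitely many. As \<open>z 0 = y\<close>, the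
  first relation gives \<open>rel\<close> for 0, and conjugation by \<open>x\<close> gives the rest.
  Then \<open>z (n + 3)\<close> is a product of \<open>z (n + 1)\<close>, its inverse and
  \<open>z (n + 2)\<close>, so commutation with \<open>c\<close> propagates.\<close>

lemma conj_pow_commute:
  assumes xy: "x \<in> carrier G" "y \<in> carrier G"
    and c: "c = y \<otimes> inv x"
    and z: "\<And>n. z n = inv (x [^] n) \<otimes> y \<otimes> x [^] (n::nat)"
    and 1: "c \<otimes> z 1 = z 1 \<otimes> c" and 2: "c \<otimes> z 2 = z 2 \<otimes> c"
  shows "c \<otimes> z (Suc n) = z (Suc n) \<otimes> c"
proof -
  have cl: "c \<in> carrier G" "z n \<in> carrier G" for n using xy by (simp_all add: c z)
  have z_Suc: "z (Suc n) = inv x \<otimes> z n \<otimes> x" for n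
    using xy by (simp add: z inv_mult_group m_assoc)
  have conj_mult: "inv x \<otimes> g \<otimes> x \<otimes> (inv x \<otimes> h \<otimes> x) = inv x \<otimes> (g \<otimes> h) \<otimes> x"
    if "g \<in> carrier G" "h \<in> carrier G" for g h
    using xy that by (simp add: m_assoc r_inv_cancel)
  have rel: "z n \<otimes> z (Suc (Suc n)) = z (Suc n) \<otimes> z n" for n
  proof (induction n)
    case 0
    have "y \<otimes> (inv x \<otimes> z 1 \<otimes> x) = c \<otimes> z 1 \<otimes> x"
      using xy cl(2)[of 1] by (simp add: c m_assoc)
    also have "\<dots> = z 1 \<otimes> y" unfolding 1 using xy cl(2)[of 1] by (simp add: c m_assoc)
    finally show ?case using z_Suc[of 1] xy z[of 0] by simp
  next
    case (Suc n)
    then show ?case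
      using conj_mult[OF cl(2) cl(2)] by (metis z_Suc)
  qed
  have "c \<otimes> z (Suc n) = z (Suc n) \<otimes> c \<and> c \<otimes> z (Suc (Suc n)) = z (Suc (Suc n)) \<otimes> c"
  proof (induction n)
    case 0
    then show ?case using 1 2 by (simp add: numeral_2_eq_2)
  next
    case (Suc n)
    have "z (Suc (Suc (Suc n))) = inv (z (Suc n)) \<otimes> (z (Suc (Suc n)) \<otimes> z (Suc n))"
      using cl by (simp add: l_inv_cancel flip: rel)
    then show ?case using Suc cl by (simp add: commute_mult commute_inv)
  qed
  then show ?thesis ..
qed

text \<open>One factor is the conjugate of \<open>c\<close> by a power of \<open>x\<close>, the
  other is the product of \<open>z k\<close> down to \<open>z 1\<close>. For \<open>x0\<close> and
  \<open>x1\<close> they act on the line with disjoint supports.\<close>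

lemma seesaw_commute:
  assumes xy: "x \<in> carrier G" "y \<in> carrier G"
    and c: "c = y \<otimes> inv x"
    and 1: "c \<otimes> (inv x \<otimes> y \<otimes> x) = inv x \<otimes> y \<otimes> x \<otimes> c"
    and 2: "c \<otimes> (inv x \<otimes> inv x \<otimes> y \<otimes> x \<otimes> x) = inv x \<otimes> inv x \<otimes> y \<otimes> x \<otimes> x \<otimes> c"
  shows "x [^] k \<otimes> y \<otimes> inv x [^] (Suc k) \<otimes> (inv x [^] k \<otimes> (y \<otimes> x) [^] k) =
    inv x [^] k \<otimes> (y \<otimes> x) [^] k \<otimes> (x [^] k \<otimes> y \<otimes> inv x [^] (Suc (k::nat)))"
proof -
  define z where "z n = inv (x [^] n) \<otimes> y \<otimes> x [^] (n::nat)" for n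
  have cl: "c \<in> carrier G" "z n \<in> carrier G" for n using xy by (simp_all add: c z_def)
  have comm: "c \<otimes> z (Suc n) = z (Suc n) \<otimes> c" for n
    by (rule conj_pow_commute[OF xy c z_def])
      (use xy 1 2 in \<open>simp_all add: z_def m_assoc numeral_2_eq_2 inv_mult_group\<close>)
  define d where "d = x [^] k \<otimes> c \<otimes> inv (x [^] k)"
  have dcl: "d \<in> carrier G" using xy cl by (simp add: d_def)
  have d_z: "d \<otimes> z (Suc n) = z (Suc n) \<otimes> d" for n
    unfolding d_def
  proof (rule commute_conj)
    have "inv (x [^] k) \<otimes> z (Suc n) \<otimes> x [^] k = z (Suc (n + k))"
    proof -
      have "inv (x [^] k) \<otimes> z (Suc n) \<otimes> x [^] k =
          inv (x [^] Suc n \<otimes> x [^] k) \<otimes> y \<otimes> (x [^] Suc n \<otimes> x [^] k)"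
        using xy by (simp add: z_def inv_mult_group m_assoc)
      then show ?thesis by (simp only: nat_pow_mult[OF xy(1)] z_def add_Suc)
    qed
    then show "c \<otimes> (inv (x [^] k) \<otimes> z (Suc n) \<otimes> x [^] k) =
        inv (x [^] k) \<otimes> z (Suc n) \<otimes> x [^] k \<otimes> c"
      using comm by simp
  qed (use xy cl in auto)
  have "d \<otimes> (inv (x [^] m) \<otimes> (y \<otimes> x) [^] m) = inv (x [^] m) \<otimes> (y \<otimes> x) [^] m \<otimes> d" for m :: nat
  proof (induction m)
    case 0
    then show ?case using dcl by simp
  next
    case (Suc m)
    have "inv (x [^] Suc m) \<otimes> (y \<otimes> x) [^] Suc m =
        z (Suc m) \<otimes> (inv (x [^] m) \<otimes> (y \<otimes> x) [^] m)"
      using xy nat_pow_Suc2[of "y \<otimes> x" m] nat_pow_Suc2[of x m]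
      by (simp add: z_def m_assoc inv_mult_group l_inv_cancel r_inv_cancel)
    then show ?case using Suc d_z xy cl dcl by (simp add: commute_mult)
  qed
  moreover have "d = x [^] k \<otimes> y \<otimes> inv x [^] (Suc k)"
    unfolding d_def c using xy nat_pow_Suc2[of "inv x" k] by (simp add: m_assoc nat_pow_inv)
  ultimately show ?thesis using xy by (simp add: nat_pow_inv)
qed

end

section \<open>Words as elements of \<open>F\<close>\<close>

abbreviation val :: "letter list \<Rightarrow> letter list set" where
  "val \<equiv> pres_class thompson_relators"

lemma val_append: "val (u @ v) = val u \<otimes>\<^bsub>thompson_F\<^esub> val v"
  by (simp add: thompson_F_def mult_pres_class)

lemma val_Nil: "val [] = \<one>\<^bsub>thompson_F\<^esub>"
  by (simp add: thompson_F_def presented_group_def)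

lemma val_closed [simp]: "val u \<in> carrier thompson_F"
  by (simp add: thompson_F_def presented_group_def)

lemma val_inv_word: "val (inv_word u) = inv\<^bsub>thompson_F\<^esub> val u"
  by (simp add: thompson_F_def inv_pres_class)

lemma val_letters:
  "val [up] = x0" "val [stretch] = x1"
  "val [down] = inv\<^bsub>thompson_F\<^esub> x0" "val [shrink] = inv\<^bsub>thompson_F\<^esub> x1"
  using val_inv_word[of "[up]"] val_inv_word[of "[stretch]"]
  by (simp_all add: inv_word_def x0_def x1_def pres_gen_def)

lemma x_closed [simp]: "x0 \<in> carrier thompson_F" "x1 \<in> carrier thompson_F"
  using val_letters(1,2) val_closed by metis+

lemma val_replicate: "val (replicate n l) = val [l] [^]\<^bsub>thompson_F\<^esub> n"
proof -
  interpret group thompson_F by (rule group_thompson_F)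
  show ?thesis
  proof (induction n)
    case (Suc n)
    have "val (replicate (Suc n) l) = val (replicate n l @ [l])"
      by (simp add: replicate_append_same)
    then show ?case by (simp add: val_append Suc)
  qed (simp add: val_Nil)
qed

lemma val_staircase: "val (staircase n) = (x1 \<otimes>\<^bsub>thompson_F\<^esub> x0) [^]\<^bsub>thompson_F\<^esub> n"
proof -
  interpret group thompson_F by (rule group_thompson_F)
  have st: "val [stretch, up] = x1 \<otimes>\<^bsub>thompson_F\<^esub> x0"
    using val_append[of "[stretch]" "[up]"] by (simp add: val_letters)
  show ?thesis
  proof (induction n)
    case (Suc n)
    then show ?case using staircase_add[of n 1]
      by (simp add: val_append staircase_def[of "Suc 0"] st)
  qed (simp add: val_Nil staircase_def)
qed

lemma val_commutator_word:
  assumes "commutator_word u v \<in> thompson_relators"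
  shows "val u \<otimes>\<^bsub>thompson_F\<^esub> val v = val v \<otimes>\<^bsub>thompson_F\<^esub> val u"
proof -
  interpret group thompson_F by (rule group_thompson_F)
  have "val (commutator_word u v) = \<one>\<^bsub>thompson_F\<^esub>"
    using pres_eq.relator[OF assms, of "[]" "[]"] by (simp add: pres_class_eq_iff flip: val_Nil)
  then have "val u \<otimes>\<^bsub>thompson_F\<^esub> val v \<otimes>\<^bsub>thompson_F\<^esub> inv\<^bsub>thompson_F\<^esub> (val v \<otimes>\<^bsub>thompson_F\<^esub> val u) = \<one>\<^bsub>thompson_F\<^esub>"
    by (simp add: commutator_word_def val_append val_inv_word m_assoc inv_mult_group)
  then show ?thesis by (metis inv_equality inv_inv inv_closed m_closed val_closed)
qed

lemma val_seesaw: "val (seesaw k) = val (seesaw' k)"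
proof -
  interpret group thompson_F by (rule group_thompson_F)
  define c where "c = x1 \<otimes>\<^bsub>thompson_F\<^esub> inv\<^bsub>thompson_F\<^esub> x0"
  have c: "c \<in> carrier thompson_F" by (simp add: c_def)
  have c_comm: "c \<otimes>\<^bsub>thompson_F\<^esub> val v = val v \<otimes>\<^bsub>thompson_F\<^esub> c"
    if "commutator_word [up, shrink] v \<in> thompson_relators" for v
  proof -
    have "val [up, shrink] = inv\<^bsub>thompson_F\<^esub> c"
      using val_append[of "[up]" "[shrink]"] by (simp add: val_letters c_def inv_mult_group)
    then have "val v \<otimes>\<^bsub>thompson_F\<^esub> inv\<^bsub>thompson_F\<^esub> c = inv\<^bsub>thompson_F\<^esub> c \<otimes>\<^bsub>thompson_F\<^esub> val v"
      using val_commutator_word[OF that] by simp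
    from commute_inv[OF this] c show ?thesis by simp
  qed
  have v1: "val [down, stretch, up] = inv\<^bsub>thompson_F\<^esub> x0 \<otimes>\<^bsub>thompson_F\<^esub> x1 \<otimes>\<^bsub>thompson_F\<^esub> x0"
    using val_append[of "[down]" "[stretch, up]"] val_append[of "[stretch]" "[up]"]
    by (simp add: val_letters m_assoc)
  have v2: "val [down, down, stretch, up, up] = inv\<^bsub>thompson_F\<^esub> x0 \<otimes>\<^bsub>thompson_F\<^esub> inv\<^bsub>thompson_F\<^esub> x0
      \<otimes>\<^bsub>thompson_F\<^esub> x1 \<otimes>\<^bsub>thompson_F\<^esub> x0 \<otimes>\<^bsub>thompson_F\<^esub> x0"
    using val_append[of "[down]" "[down, stretch, up, up]"] val_append[of "[down, stretch, up]" "[up]"]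
    by (simp add: val_letters m_assoc v1)
  have "c \<otimes>\<^bsub>thompson_F\<^esub> val [down, stretch, up] = val [down, stretch, up] \<otimes>\<^bsub>thompson_F\<^esub> c"
    "c \<otimes>\<^bsub>thompson_F\<^esub> val [down, down, stretch, up, up] =
      val [down, down, stretch, up, up] \<otimes>\<^bsub>thompson_F\<^esub> c"
    by (rule c_comm, simp add: thompson_relators_def)+
  note comm = this[unfolded v1 v2]
  have "val (stretch # replicate (k + 1) down) =
      x1 \<otimes>\<^bsub>thompson_F\<^esub> inv\<^bsub>thompson_F\<^esub> x0 [^]\<^bsub>thompson_F\<^esub> Suc k"
    using val_append[of "[stretch]" "replicate (Suc k) down"] val_replicate[of "Suc k" down]
    by (simp add: val_letters)
  then show ?thesis
    unfolding seesaw_def seesaw'_def val_append val_replicate val_letters val_staircase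
    using seesaw_commute[OF _ _ c_def comm, of k] by (simp add: m_assoc del: nat_pow_Suc)
qed


section \<open>Pumping\<close>

lemma sym_gens_thompson_F: "sym_gens thompson_F {x0, x1} = range (\<lambda>l. val [l])"
proof -
  have "l \<in> {up, down, stretch, shrink}" for l :: letter
    by (cases l rule: letter_cases) simp_all
  then have U: "(UNIV :: letter set) = {up, down, stretch, shrink}" by blast
  show ?thesis unfolding U by (auto simp: sym_gens_def val_letters)
qed

lemma word_value_letters: "word_value thompson_F (map (\<lambda>l. val [l]) u) = val u"
proof (induction u)
  case (Cons l u)
  then show ?case using val_append[of "[l]" u] by (simp add: word_value_def)
qed (simp add: word_value_def val_Nil)

lemma word_length_le: "word_length thompson_F {x0, x1} (val u) \<le> length u"
  unfolding word_length_def
proof (rule Least_le, rule bexI)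
  show "word_value thompson_F (map (\<lambda>l. val [l]) u) = val u \<and> length (map (\<lambda>l. val [l]) u) = length u"
    by (simp add: word_value_letters)
qed (auto simp: sym_gens_thompson_F)

text \<open>One of the two spellings begins with the inverse of \<open>x\<close>, which cancels a
  letter of the power in front of it.\<close>

lemma word_length_power_seesaw:
  assumes "x \<in> {up, down}" "0 < d" "0 < k"
  shows "word_length thompson_F {x0, x1} (val (replicate d x @ seesaw k)) < d + (5 * k + 2)"
proof -
  obtain s where s: "val (seesaw k) = val ((X0, \<not> snd x) # s)" "length s = 5 * k + 1"
  proof (cases "x = up")
    case True
    then show ?thesis using that[of "tl (seesaw k)"] assms(3)
      by (cases k) (auto simp: seesaw_def)
  next
    case False
    then show ?thesis using that[of "tl (seesaw' k)"] assms(1,3)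
      by (cases k) (auto simp: seesaw'_def val_seesaw)
  qed
  have x: "x = (X0, snd x)" using assms(1) by auto
  obtain e where e: "d = Suc e" using assms(2) by (cases d) auto
  have "val (replicate d x @ seesaw k) = val (replicate d x @ (X0, \<not> snd x) # s)"
    by (simp add: val_append s)
  also have "replicate d x @ (X0, \<not> snd x) # s = replicate e x @ [(X0, snd x), (X0, \<not> snd x)] @ s"
    using x by (simp add: e replicate_app_Cons_same)
  also have "val \<dots> = val (replicate e x @ s)"
    unfolding pres_class_eq_iff by (rule pres_eq.cancel)
  finally show ?thesis using word_length_le[of "replicate e x @ s"] by (simp add: s(2) e)
qed

text \<open>Two of the \<open>k + 1\<close> states after the powers of \<open>a\<close> up to
  \<open>k\<close> coincide; running through this loop once more leads to the same state before
  \<open>v\<close>.\<close>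

lemma dfa_pumping:
  assumes M: "is_dfa A M" and w: "replicate k a @ v \<in> dfa_language A M"
    and k: "card (states M) \<le> k" "0 < k"
  obtains d where "0 < d" "replicate (d + k) a @ v \<in> dfa_language A M"
proof -
  define q where "q i = foldl (step M) (start M) (replicate i a)" for i
  have a: "a \<in> A" using w k(2) by (auto simp: dfa_language_def)
  have q_Suc: "q (Suc i) = step M (q i) a" for i
    by (simp add: q_def flip: replicate_append_same)
  have q: "q i \<in> states M" for i
    using M a by (induction i) (auto simp: is_dfa_def q_Suc, simp add: q_def)
  have "\<not> inj_on q {..k}"
  proof
    assume "inj_on q {..k}"
    then have "card {..k} \<le> card (states M)"
      using M q by (intro card_inj_on_le) (auto simp: is_dfa_def)
    with k show False by simp
  qed
  then obtain i j where ij: "i < j" "j \<le> k" "q i = q j"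
    unfolding inj_on_def by (metis atMost_iff linorder_neqE_nat)
  have shift: "q (i + n) = q (j + n)" for n
    by (induction n) (simp_all add: ij q_Suc)
  have "q (j - i + k) = q k" using shift[of "k - i"] ij by (simp add: add.commute)
  then have "replicate (j - i + k) a @ v \<in> dfa_language A M"
    using w a unfolding dfa_language_def q_def by auto
  with that[of "j - i"] ij show ?thesis by simp
qed

theorem mainTheorem11:
  shows "\<not> (\<exists>L. language_of_geodesics thompson_F {x0, x1} L \<and>
                regular_language (sym_gens thompson_F {x0, x1}) L)"
proof
  let ?A = "sym_gens thompson_F {x0, x1}" and ?l = "\<lambda>l. val [l]"
  assume "\<exists>L. language_of_geodesics thompson_F {x0, x1} L \<and> regular_language ?A L"
  then obtain M where M: "is_dfa ?A M"
    and L: "language_of_geodesics thompson_F {x0, x1} (dfa_language ?A M)"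
    by (auto simp: regular_language_def)
  \<comment> \<open>The number of states lets the initial power be pumped; the 4 meets the
    assumption of \<open>seesaw_word\<close>.\<close>
  define k where "k = card (states M) + 4"
  obtain w where w: "w \<in> dfa_language ?A M" "word_value thompson_F w = val (seesaw k)"
    using L val_closed unfolding language_of_geodesics_def by blast
  then have "geodesic thompson_F {x0, x1} w" using L by (simp add: language_of_geodesics_def)
  then have w_len: "length w \<le> 5 * k + 2"
    using word_length_le[of "seesaw k"] w(2) by (simp add: geodesic_def seesaw_def)
  have "w \<in> lists (range ?l)" using w(1) by (simp add: dfa_language_def sym_gens_thompson_F)
  then obtain u where u: "w = map ?l u" by (auto simp: lists_image)
  have val_u: "val u = val (seesaw k)" using w(2) by (simp add: u word_value_letters)
  then interpret seesaw_word k u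
    by (intro seesaw_word_if_pres_eq)
      (use w_len in \<open>simp_all add: u k_def pres_class_eq_iff\<close>)
  obtain x v where x: "x \<in> {up, down}" and u_eq: "u = replicate k x @ v"
    and len: "length u = 5 * k + 2"
    using begins_with_power by blast
  have "replicate k (?l x) @ map ?l v \<in> dfa_language ?A M" using w(1) by (simp add: u u_eq)
  from dfa_pumping[OF M this] obtain d
    where d: "0 < d" "replicate (d + k) (?l x) @ map ?l v \<in> dfa_language ?A M"
    by (auto simp: k_def)
  have eq: "replicate (d + k) (?l x) @ map ?l v = map ?l (replicate d x @ u)"
    by (simp add: u_eq replicate_add)
  have "geodesic thompson_F {x0, x1} (map ?l (replicate d x @ u))"
    using L d(2) unfolding eq language_of_geodesics_def by blast
  then have "d + (5 * k + 2) = word_length thompson_F {x0, x1} (val (replicate d x @ u))"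
    by (simp add: geodesic_def word_value_letters len del: map_append)
  also have "val (replicate d x @ u) = val (replicate d x @ seesaw k)"
    by (simp add: val_append val_u)
  also have "word_length thompson_F {x0, x1} \<dots> < d + (5 * k + 2)"
    using x d(1) by (rule word_length_power_seesaw) (simp add: k_def)
  finally show False by simp
qed

end
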